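(* For every infinite-dimensional Banach space $E$, the weak$^\ast$ dual $E'_{w^\ast}$ of $E$ does not have the strong Gelfand--Phillips property.
   Context: Spaces are over the field $\mathbb{F}$ of real or complex numbers. $E'_{w^\ast}$ is the dual space $E'$ endowed with the weak$^\ast$ topology $\sigma(E',E)$. For a Hausdorff locally convex space $H$: a barrel is a closed absolutely convex absorbing subset. A set $B\subseteq H$ is barrel-bounded if for every barrel $U\subseteq H$ there is $n\in\omega$ with $B\subseteq nU$. A set $A\subseteq H$ is barrel-precompact if for every barrel $U\subseteq H$ there is a finite set $F\subseteq H$ with $A\subseteq F+U$. For $B\subseteq H$ and $\chi\in H'$, $\|\chi\|_B:=\sup\{|\chi(x)|:x\in B\cup\{0\}\}$. $H$ has the strong Gelfand--Phillips property if there is a weak$^\ast$ null sequence $\{\chi_n\}_{n\in\omega}$ in $H'$ such that $\|\chi_n\|_B\not\to 0$ for every barrel-bounded set $B\subseteq H$ which is not barrel-precompact. *)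

theory Defs
  imports "HOL-Analysis.Analysis" "HOL-Library.Function_Algebras"
begin

text \<open>
  A topological vector space over a normed field (below the real or the complex numbers) is given
  by its scalar multiplication and its topology; the underlying vector space is the topspace, which
  may be a proper linear subspace of the ambient type. This is needed because the dual of a space
  is a proper subspace of a function type, whose addition is pointwise.
\<close>

definition infinite_dimensional :: "('k::field \<Rightarrow> 'v::ab_group_add \<Rightarrow> 'v) \<Rightarrow> bool" where
  "infinite_dimensional smul \<longleftrightarrow> \<not> (\<exists>B. finite B \<and> module.span smul B = UNIV)"

text \<open>
  A complex Banach space is a real Banach space with a complex scalar multiplication that extends
  the real one and for which the norm is homogeneous.
\<close>

locale complex_banach = vector_space smul
  for smul :: "complex \<Rightarrow> 'e::banach \<Rightarrow> 'e" +
  assumes smul_of_real: "smul (of_real r) x = r *\<^sub>R x"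
    and norm_smul: "norm (smul c x) = norm c * norm x"

text \<open>
  Functionals are required to vanish outside the space, so that each functional on the space is
  represented by exactly one function on the ambient type.
\<close>

definition topological_dual ::
    "('k::real_normed_field \<Rightarrow> 'v::ab_group_add \<Rightarrow> 'v) \<Rightarrow> 'v topology \<Rightarrow> ('v \<Rightarrow> 'k) set" where
  "topological_dual smul T =
     {f. (\<forall>x\<in>topspace T. \<forall>y\<in>topspace T. f (x + y) = f x + f y) \<and>
         (\<forall>c. \<forall>x\<in>topspace T. f (smul c x) = c * f x) \<and>
         continuous_map T euclidean f \<and>
         (\<forall>x. x \<notin> topspace T \<longrightarrow> f x = 0)}"

definition weak_star_dual ::
    "('k::real_normed_field \<Rightarrow> 'v::ab_group_add \<Rightarrow> 'v) \<Rightarrow> 'v topology \<Rightarrow> ('v \<Rightarrow> 'k) topology" where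
  "weak_star_dual smul T =
     topology_generated_by
       {{f \<in> topological_dual smul T. f x \<in> W} | x W. x \<in> topspace T \<and> open W}"

definition fun_scale :: "'k::times \<Rightarrow> ('v \<Rightarrow> 'k) \<Rightarrow> 'v \<Rightarrow> 'k" where
  "fun_scale c f = (\<lambda>x. c * f x)"

definition absolutely_convex ::
    "('k::real_normed_field \<Rightarrow> 'v::ab_group_add \<Rightarrow> 'v) \<Rightarrow> 'v set \<Rightarrow> bool" where
  "absolutely_convex smul U \<longleftrightarrow>
     (\<forall>x\<in>U. \<forall>y\<in>U. \<forall>a b. norm a + norm b \<le> 1 \<longrightarrow> smul a x + smul b y \<in> U)"

definition absorbing ::
    "('k::real_normed_field \<Rightarrow> 'v::ab_group_add \<Rightarrow> 'v) \<Rightarrow> 'v set \<Rightarrow> 'v set \<Rightarrow> bool" where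
  "absorbing smul V U \<longleftrightarrow> (\<forall>x\<in>V. \<exists>r>0. \<forall>c. norm c \<ge> r \<longrightarrow> x \<in> smul c ` U)"

definition barrel ::
    "('k::real_normed_field \<Rightarrow> 'v::ab_group_add \<Rightarrow> 'v) \<Rightarrow> 'v topology \<Rightarrow> 'v set \<Rightarrow> bool" where
  "barrel smul T U \<longleftrightarrow>
     closedin T U \<and> absolutely_convex smul U \<and> absorbing smul (topspace T) U"

definition barrel_bounded ::
    "('k::real_normed_field \<Rightarrow> 'v::ab_group_add \<Rightarrow> 'v) \<Rightarrow> 'v topology \<Rightarrow> 'v set \<Rightarrow> bool" where
  "barrel_bounded smul T B \<longleftrightarrow>
     B \<subseteq> topspace T \<and> (\<forall>U. barrel smul T U \<longrightarrow> (\<exists>n::nat. B \<subseteq> smul (of_nat n) ` U))"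

definition barrel_precompact ::
    "('k::real_normed_field \<Rightarrow> 'v::ab_group_add \<Rightarrow> 'v) \<Rightarrow> 'v topology \<Rightarrow> 'v set \<Rightarrow> bool" where
  "barrel_precompact smul T A \<longleftrightarrow>
     A \<subseteq> topspace T \<and>
     (\<forall>U. barrel smul T U \<longrightarrow>
        (\<exists>F. finite F \<and> F \<subseteq> topspace T \<and> A \<subseteq> {x + u | x u. x \<in> F \<and> u \<in> U}))"

text \<open>The supremum is taken in the extended reals, so it is meaningful for every set.\<close>

definition sup_on :: "('v::zero \<Rightarrow> 'k::real_normed_field) \<Rightarrow> 'v set \<Rightarrow> ereal" where
  "sup_on \<phi> B = (SUP x \<in> B \<union> {0}. ereal (norm (\<phi> x)))"

text \<open>
  The notion is meant for Hausdorff locally convex spaces, but this is deliberately not a conjunct: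
  the property gets negated, and a conjunct would only weaken its negation.
\<close>

definition strong_gelfand_phillips ::
    "('k::real_normed_field \<Rightarrow> 'v::ab_group_add \<Rightarrow> 'v) \<Rightarrow> 'v topology \<Rightarrow> bool" where
  "strong_gelfand_phillips smul T \<longleftrightarrow>
     (\<exists>\<phi> :: nat \<Rightarrow> 'v \<Rightarrow> 'k.
        (\<forall>n. \<phi> n \<in> topological_dual smul T) \<and>
        limitin (weak_star_dual smul T) \<phi> 0 sequentially \<and>
        (\<forall>B. barrel_bounded smul T B \<and> \<not> barrel_precompact smul T B \<longrightarrow>
             \<not> (\<lambda>n. sup_on (\<phi> n) B) \<longlonglongrightarrow> 0))"

end

theory Submission imports Defs
begin

text \<open>
  A weak* null sequence \<open>\<phi> n\<close> in the dual of \<open>E'\<close> with its weak* topology is a weakly null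
  sequence in \<open>E\<close>; it defines an operator \<open>T f = (\<phi> n f)\<^sub>n\<close> from \<open>E'\<close> to \<open>c\<^sub>0\<close>. If \<open>T\<close> is
  bounded below on no annihilator of a finite set, then one picks norm-one functionals \<open>g k\<close>
  that are uniformly separated and satisfy \<open>T (g k) \<rightarrow> 0\<close>; their range is bounded but not
  precompact, and \<open>\<phi> n\<close> tends to zero uniformly on it. Otherwise \<open>T\<close> embeds a weak* closed
  subspace of finite codimension into \<open>c\<^sub>0\<close>, which is impossible by a gliding hump: blocks in that
  subspace have bounded partial sums, and \<open>T\<close> maps a weak* cluster point of them to a sequence that
  does not tend to zero. By Baire's theorem in the weak* compact dual ball every barrel is a
  neighbourhood of zero for the norm, so that norm bounded sets are barrel-bounded; conversely the
  dual balls are barrels.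
\<close>

subsection \<open>Separating functionals\<close>

text \<open>Homogeneity is asked for as an inequality with positive factors, which leaves little to
  check for tilts and infima; scaling back by the inverse factor turns it into an equality.\<close>

definition sublinear :: "('a::real_vector \<Rightarrow> real) \<Rightarrow> bool" where
  "sublinear p \<longleftrightarrow> (\<forall>x y. p (x + y) \<le> p x + p y) \<and> (\<forall>r x. 0 < r \<longrightarrow> p (r *\<^sub>R x) \<le> r * p x)"

lemma sublinear_norm: "sublinear norm"
  by (simp add: sublinear_def norm_triangle_ineq)

lemma sublinear_add: "sublinear p \<Longrightarrow> p (x + y) \<le> p x + p y"
  by (simp add: sublinear_def)

lemma sublinear_zero:
  assumes "sublinear p"
  shows "p 0 = 0"
proof -
  have "p (2 *\<^sub>R 0) \<le> 2 * p 0" "p ((1/2) *\<^sub>R 0) \<le> (1/2) * p 0"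
    using assms by (simp_all only: sublinear_def)
  then show ?thesis by simp
qed

lemma sublinear_scaleR:
  assumes "sublinear p" "0 \<le> r"
  shows "p (r *\<^sub>R x) = r * p x"
proof (cases "r = 0")
  case True
  then show ?thesis using sublinear_zero[OF assms(1)] by simp
next
  case False
  then have r: "r > 0" using assms by simp
  have "p (inverse r *\<^sub>R (r *\<^sub>R x)) \<le> inverse r * p (r *\<^sub>R x)"
    using assms r unfolding sublinear_def by (metis inverse_positive_iff_positive)
  then have "p x \<le> inverse r * p (r *\<^sub>R x)"
    using r by simp
  then have "r * p x \<le> p (r *\<^sub>R x)"
    using r by (simp add: field_simps)
  moreover have "p (r *\<^sub>R x) \<le> r * p x" using assms r by (simp add: sublinear_def)
  ultimately show ?thesis by simp
qed

lemma sublinear_minus: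
  assumes "sublinear p"
  shows "- p (- x) \<le> p x"
  using sublinear_add[OF assms, of x "- x"] sublinear_zero[OF assms] by simp

text \<open>Since \<open>tilt p y \<le> p\<close> is again sublinear, a minimal sublinear \<open>p\<close> equals all its tilts, which
  makes it superadditive.\<close>

definition tilt :: "('a::real_vector \<Rightarrow> real) \<Rightarrow> 'a \<Rightarrow> 'a \<Rightarrow> real" where
  "tilt p y x = (INF t\<in>{0..}. p (x + t *\<^sub>R y) - t * p y)"

lemma tilt_le:
  assumes "sublinear p" "0 \<le> t"
  shows "tilt p y x \<le> p (x + t *\<^sub>R y) - t * p y"
  unfolding tilt_def
proof (rule cINF_lower)
  show "bdd_below ((\<lambda>t. p (x + t *\<^sub>R y) - t * p y) ` {0..})"
  proof (rule bdd_belowI2)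
    fix s :: real assume "s \<in> {0..}"
    \<comment> \<open>Subadditivity for \<open>s *\<^sub>R y = (x + s *\<^sub>R y) + (- x)\<close>
      gives a lower bound that does not depend on \<open>s\<close>, so the infimum is a genuine real
      number.\<close>
    then show "- p (- x) \<le> p (x + s *\<^sub>R y) - s * p y"
      using sublinear_add[OF assms(1), of "x + s *\<^sub>R y" "- x"] sublinear_scaleR[OF assms(1), of s y]
      by simp
  qed
qed (use assms in simp)

lemma tilt_greatest:
  assumes "\<And>t. 0 \<le> t \<Longrightarrow> c \<le> p (x + t *\<^sub>R y) - t * p y"
  shows "c \<le> tilt p y x"
  unfolding tilt_def by (rule cINF_greatest) (use assms in auto)

lemma sublinear_tilt:
  assumes p: "sublinear p"
  shows "sublinear (tilt p y)"
  unfolding sublinear_def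
proof (intro conjI allI impI)
  fix x x'
  \<comment> \<open>The parameters add up: \<open>t + t'\<close> competes in the infimum at
    \<open>x + x'\<close>. The infima over \<open>t\<close> and over \<open>t'\<close> are then
    taken one after the other.\<close>
  have "tilt p y (x + x') - (p (x' + t' *\<^sub>R y) - t' * p y) \<le> p (x + t *\<^sub>R y) - t * p y"
    if "0 \<le> t" "0 \<le> t'" for t t'
    using tilt_le[OF p, of "t + t'" y "x + x'"] that
      sublinear_add[OF p, of "x + t *\<^sub>R y" "x' + t' *\<^sub>R y"]
    by (simp add: algebra_simps)
  then have "tilt p y (x + x') - (p (x' + t' *\<^sub>R y) - t' * p y) \<le> tilt p y x" if "0 \<le> t'" for t'
    using that by (intro tilt_greatest) auto
  then have "tilt p y (x + x') - tilt p y x \<le> p (x' + t' *\<^sub>R y) - t' * p y" if "0 \<le> t'" for t'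
    using that by (smt (verit))
  then have "tilt p y (x + x') - tilt p y x \<le> tilt p y x'"
    by (intro tilt_greatest)
  then show "tilt p y (x + x') \<le> tilt p y x + tilt p y x'" by simp
next
  fix r :: real and x assume r: "0 < r"
  have "inverse r * tilt p y (r *\<^sub>R x) \<le> p (x + t *\<^sub>R y) - t * p y" if "0 \<le> t" for t
  proof -
    have "tilt p y (r *\<^sub>R x) \<le> p (r *\<^sub>R (x + t *\<^sub>R y)) - r * t * p y"
      using tilt_le[OF p, of "r * t" y "r *\<^sub>R x"] r that by (simp add: algebra_simps)
    also have "\<dots> = r * (p (x + t *\<^sub>R y) - t * p y)"
      using r by (subst sublinear_scaleR[OF p]) (simp_all add: algebra_simps)
    finally show ?thesis using r by (simp add: field_simps)
  qed
  then have "inverse r * tilt p y (r *\<^sub>R x) \<le> tilt p y x"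
    by (rule tilt_greatest)
  then show "tilt p y (r *\<^sub>R x) \<le> r * tilt p y x"
    using r by (simp add: field_simps)
qed

text \<open>Zorn's lemma for the reversed pointwise order. The bound of a chain is its pointwise
  infimum, which is finite because every sublinear \<open>q\<close> below \<open>p\<close> satisfies
  \<open>- p (- x) \<le> - q (- x) \<le> q x\<close>.\<close>

lemma minimal_sublinear_exists:
  assumes p: "sublinear p"
  obtains q where "sublinear q" "q \<le> p" "\<And>q'. sublinear q' \<Longrightarrow> q' \<le> q \<Longrightarrow> q' = q"
proof -
  define A where "A = {q. sublinear q \<and> q \<le> p}"
  have "\<exists>m\<in>A. \<forall>a\<in>A. (\<lambda>q q'. q' \<le> q) m a \<longrightarrow> a = m"
  proof (rule predicate_Zorn)
    show "partial_order_on A (relation_of (\<lambda>q q'. q' \<le> q) A)"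
      by (rule partial_order_on_relation_ofI) auto
  next
    fix C assume "C \<in> Chains (relation_of (\<lambda>q q'. q' \<le> q) A)"
    then have CA: "C \<subseteq> A" and chain: "\<And>q q'. q \<in> C \<Longrightarrow> q' \<in> C \<Longrightarrow> q \<le> q' \<or> q' \<le> q"
      unfolding Chains_def relation_of_def by auto
    show "\<exists>u\<in>A. \<forall>a\<in>C. u \<le> a"
    proof (cases "C = {}")
      case True
      then show ?thesis using p by (auto simp: A_def)
    next
      case False
      define u where "u x = (INF q\<in>C. q x)" for x
      have lower: "- p (- x) \<le> q x" if "q \<in> C" for q x
      proof -
        have q: "sublinear q" "q \<le> p" using that CA by (auto simp: A_def)
        show ?thesis using sublinear_minus[OF q(1), of x] q(2) by (smt (verit) le_funD)
      qed
      have ule: "u x \<le> q x" if "q \<in> C" for q x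
        unfolding u_def by (rule cINF_lower[OF bdd_belowI2 that]) (rule lower)
      have ugreat: "c \<le> u x" if "\<And>q. q \<in> C \<Longrightarrow> c \<le> q x" for c x
        unfolding u_def by (rule cINF_greatest[OF False that])
      have "u (x + y) - q' y \<le> q x" if qq: "q \<in> C" "q' \<in> C" for q q' x y
      proof -
        \<comment> \<open>Two members of a chain have a common lower member; its subadditivity
          replaces the one that mixed members lack.\<close>
        obtain r where r: "r \<in> C" "r \<le> q" "r \<le> q'" using chain[OF qq] qq by blast
        then have "u (x + y) \<le> r x + r y"
          using ule[OF r(1), of "x + y"] CA sublinear_add[of r x y] by (force simp: A_def)
        then show ?thesis using le_funD[OF r(2), of x] le_funD[OF r(3), of y] by simp
      qed
      then have "u (x + y) - q' y \<le> u x" if "q' \<in> C" for q' x y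
        using that by (intro ugreat) auto
      then have "u (x + y) - u x \<le> u y" for x y
        by (intro ugreat) (smt (verit))
      moreover have "u (r *\<^sub>R x) \<le> r * u x" if r: "0 < r" for r x
      proof -
        have "inverse r * u (r *\<^sub>R x) \<le> q x" if "q \<in> C" for q
          using ule[OF that, of "r *\<^sub>R x"] sublinear_scaleR[of q r x] that CA r
          by (auto simp: A_def field_simps)
        then have "inverse r * u (r *\<^sub>R x) \<le> u x" by (rule ugreat)
        then show ?thesis using r by (simp add: field_simps)
      qed
      ultimately have "sublinear u" unfolding sublinear_def by (smt (verit))
      moreover have "u \<le> p"
      proof -
        obtain q where q: "q \<in> C" using False by blast
        then have "q \<le> p" using CA by (auto simp: A_def)
        then show ?thesis using ule[OF q] by (auto simp: le_fun_def intro: order_trans)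
      qed
      ultimately show ?thesis using ule by (auto simp: A_def le_fun_def)
    qed
  qed
  then obtain m where m: "m \<in> A" "\<And>a. a \<in> A \<Longrightarrow> a \<le> m \<Longrightarrow> a = m" by auto
  show ?thesis
  proof (rule that[of m])
    show "sublinear m" "m \<le> p" using m(1) by (auto simp: A_def)
    fix q' assume "sublinear q'" "q' \<le> m"
    then show "q' = m" using m by (auto simp: A_def intro: order_trans)
  qed
qed

lemma linear_if_minimal_sublinear:
  assumes q: "sublinear q" and min: "\<And>q'. sublinear q' \<Longrightarrow> q' \<le> q \<Longrightarrow> q' = q"
  shows "linear q"
proof -
  have "tilt q y = q" for y
    by (rule min[OF sublinear_tilt[OF q]]) (use tilt_le[OF q, of 0] in \<open>auto simp: le_fun_def\<close>)
  \<comment> \<open>With parameter 1, \<open>q x = tilt q y x \<le> q (x + y) - q y\<close>.\<close>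
  then have "q x + q y \<le> q (x + y)" for x y
    using tilt_le[OF q, of 1 y x] by simp
  then have add: "q (x + y) = q x + q y" for x y
    using sublinear_add[OF q, of x y] by (simp add: antisym)
  then have neg: "q (- x) = - q x" for x
    using add[of x "- x"] sublinear_zero[OF q] by simp
  have "q (r *\<^sub>R x) = r * q x" for r x
    using sublinear_scaleR[OF q, of r x] sublinear_scaleR[OF q, of "- r" x] neg[of "r *\<^sub>R x"]
    by (cases "r \<ge> 0") auto
  then show ?thesis using add by (intro linearI) auto
qed

text \<open>The functional is a minimal sublinear functional below \<open>tilt norm z\<close>, which is already
  negative at \<open>- z\<close>.\<close>

lemma separating_functional:
  fixes z :: "'a::real_normed_vector"
  assumes "z \<noteq> 0"
  obtains q :: "'a \<Rightarrow> real" where "linear q" "\<And>x. \<bar>q x\<bar> \<le> norm x" "q z \<noteq> 0"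
proof -
  obtain q where q: "sublinear q" "q \<le> tilt norm z"
    and min: "\<And>q'. sublinear q' \<Longrightarrow> q' \<le> q \<Longrightarrow> q' = q"
    using minimal_sublinear_exists[OF sublinear_tilt[OF sublinear_norm]] by metis
  have lin: "linear q" using linear_if_minimal_sublinear[OF q(1) min] .
  then have neg: "q (- x) = - q x" for x by (rule linear_neg)
  have le: "q x \<le> norm x" for x
    using tilt_le[OF sublinear_norm, of 0 z x] le_funD[OF q(2), of x] by simp
  have "\<bar>q x\<bar> \<le> norm x" for x
    using le[of x] le[of "- x"] neg[of x] by simp
  \<comment> \<open>Parameter 1 in the tilt contributes
    \<open>norm (- z + z) - norm z\<close>.\<close>
  moreover have "q (- z) \<le> - norm z"
    using tilt_le[OF sublinear_norm, of 1 z "- z"] le_funD[OF q(2), of "- z"] by simp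
  then have "q z \<noteq> 0" using neg[of z] assms by auto
  ultimately show ?thesis using lin that by blast
qed

subsection \<open>Sequences, suprema and the product topology\<close>

lemma sum_fun_eval:
  fixes f :: "'i \<Rightarrow> 'a \<Rightarrow> 'b::comm_monoid_add"
  shows "(\<Sum>i\<in>I. f i) x = (\<Sum>i\<in>I. f i x)"
  by (induction I rule: infinite_finite_induct) auto

text \<open>With these weights the off-peak terms of the gliding hump add up to at most half of a
  unit peak.\<close>

lemma sum_quarter_geometric: "(\<Sum>k<m. (1/4) * (1/2) ^ k) = 1/2 - (1/2) * (1/2 :: real) ^ m"
  by (induction m) (auto simp: field_simps)

text \<open>Only finitely many terms reach the positive value \<open>a n0\<close>, so the maximum
  over a long enough initial segment is global.\<close>

lemma null_sequence_attains_max: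
  fixes a :: "nat \<Rightarrow> real"
  assumes "a \<longlonglongrightarrow> 0" "a n0 > 0"
  obtains m where "\<And>n. a n \<le> a m" "a m > 0"
proof -
  obtain N where N: "\<And>n. n \<ge> N \<Longrightarrow> a n < a n0"
    using order_tendstoD(2)[OF assms] by (auto simp: eventually_sequentially)
  have "Max (a ` {..N + n0}) \<in> a ` {..N + n0}" by (intro Max_in) auto
  then obtain m where m: "a m = Max (a ` {..N + n0})" by (metis imageE)
  have le: "a n \<le> a m" if "n \<le> N + n0" for n
    using that unfolding m by (intro Max_ge) auto
  have "a n \<le> a m" for n
    using le[of n] le[of n0] N[of n] by (cases "n \<le> N + n0") auto
  then show ?thesis using assms(2) by (intro that[of m]) (auto intro: less_le_trans)
qed

lemma sup_on_tendsto_zero: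
  assumes "\<And>e::real. e > 0 \<Longrightarrow> eventually (\<lambda>n. \<forall>f\<in>B \<union> {0}. norm (\<psi> n f) \<le> e) sequentially"
  shows "(\<lambda>n. sup_on (\<psi> n) B) \<longlonglongrightarrow> 0"
proof (rule order_tendstoI)
  fix a :: ereal assume "a < 0"
  moreover have "0 \<le> sup_on (\<psi> n) B" for n
    unfolding sup_on_def by (rule SUP_upper2[of 0]) auto
  ultimately show "eventually (\<lambda>n. a < sup_on (\<psi> n) B) sequentially"
    by (intro always_eventually) (auto intro: less_le_trans)
next
  fix a :: ereal assume "0 < a"
  then obtain e where e: "0 < ereal e" "ereal e < a" using ereal_dense2 by blast
  then have "eventually (\<lambda>n. \<forall>f\<in>B \<union> {0}. norm (\<psi> n f) \<le> e) sequentially"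
    by (intro assms) simp
  then show "eventually (\<lambda>n. sup_on (\<psi> n) B < a) sequentially"
  proof eventually_elim
    case (elim n)
    then have "sup_on (\<psi> n) B \<le> ereal e" unfolding sup_on_def by (intro SUP_least) auto
    then show ?case using e(2) by (rule le_less_trans)
  qed
qed

lemma absolutely_convex_scale:
  assumes "absolutely_convex fun_scale U" "u \<in> U" "norm c \<le> 1"
  shows "fun_scale c u \<in> U"
proof -
  have "fun_scale c u + fun_scale 0 u \<in> U"
    using assms unfolding absolutely_convex_def by (metis add.right_neutral norm_zero)
  then show ?thesis by (simp add: fun_scale_def plus_fun_def)
qed

lemma open_fun_finite_dist:
  fixes W :: "('a \<Rightarrow> 'b::metric_space) set"
  assumes "open W" "f \<in> W"
  obtains I \<delta> where "finite I" "\<delta> > 0" "\<And>g. (\<And>i. i \<in> I \<Longrightarrow> dist (g i) (f i) < \<delta>) \<Longrightarrow> g \<in> W"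
proof -
  obtain X where X: "f \<in> Pi\<^sub>E UNIV X" "\<And>i. open (X i)" "finite {i. X i \<noteq> UNIV}" "Pi\<^sub>E UNIV X \<subseteq> W"
    using product_topology_open_contains_basis[of "\<lambda>i. euclidean" UNIV W f] assms
    by (auto simp: open_fun_def)
  define I where "I = {i. X i \<noteq> UNIV}"
  have "\<forall>i. \<exists>d>0. ball (f i) d \<subseteq> X i"
    using X(1,2) open_contains_ball by (metis PiE_mem UNIV_I)
  then obtain d where d: "\<And>i. d i > 0" "\<And>i. ball (f i) (d i) \<subseteq> X i" by metis
  define \<delta> where "\<delta> = Min (insert 1 (d ` I))"
  have fin: "finite I" using X(3) by (simp add: I_def)
  show ?thesis
  proof (rule that[of I \<delta>])
    show "\<delta> > 0" using fin d by (auto simp: \<delta>_def)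
    fix g assume g: "\<And>i. i \<in> I \<Longrightarrow> dist (g i) (f i) < \<delta>"
    have "g i \<in> X i" for i
    proof (cases "i \<in> I")
      case True
      then have "\<delta> \<le> d i" using fin by (auto simp: \<delta>_def)
      then show ?thesis using g[OF True] d(2)[of i] by (auto simp: dist_commute)
    qed (simp add: I_def)
    then show "g \<in> W" using X(4) by auto
  qed fact
qed

subsection \<open>The dual space\<close>

text \<open>Real and complex scalars are treated together. The sort \<open>heine_borel\<close>
  supplies the compact scalar balls for Banach-Alaoglu, and separation of points is the consequence
  of Hahn-Banach that the argument uses; it is established for both fields at the end.\<close>

locale normed_space_separating_dual = vector_space smul
  for smul :: "'k::{real_normed_field,heine_borel} \<Rightarrow> 'e::real_normed_vector \<Rightarrow> 'e" +
  assumes smul_of_real: "smul (of_real r) x = r *\<^sub>R x"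
    and norm_smul: "norm (smul c x) = norm c * norm x"
    and dual_separates: "x \<noteq> 0 \<Longrightarrow> \<exists>f\<in>topological_dual smul euclidean. f x \<noteq> 0"
begin

abbreviation dual :: "('e \<Rightarrow> 'k) set" where
  "dual \<equiv> topological_dual smul euclidean"

abbreviation weak_star :: "('e \<Rightarrow> 'k) topology" where
  "weak_star \<equiv> weak_star_dual smul euclidean"

lemma dual_iff:
  "f \<in> dual \<longleftrightarrow> (\<forall>x y. f (x + y) = f x + f y) \<and> (\<forall>c x. f (smul c x) = c * f x) \<and>
     continuous_on UNIV f"
  by (simp add: topological_dual_def)

lemma dual_bounded_linear:
  assumes "f \<in> dual"
  shows "bounded_linear f"
proof -
  have add: "f (x + y) = f x + f y" and sc: "f (smul c x) = c * f x" and c: "continuous_on UNIV f"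
    for x y c using assms by (auto simp: dual_iff)
  have scR: "f (r *\<^sub>R x) = r *\<^sub>R f x" for r x
    using sc[of "of_real r" x] by (simp add: smul_of_real scaleR_conv_of_real)
  then have f0: "f 0 = 0" using scR[of 0 0] by simp
  from c have "\<exists>d>0. \<forall>x. dist x 0 < d \<longrightarrow> dist (f x) (f 0) < 1"
    unfolding continuous_on_iff by (metis UNIV_I zero_less_one)
  then obtain d where d: "d > 0" "\<And>x. norm x < d \<Longrightarrow> norm (f x) < 1"
    using f0 by auto
  have "norm (f x) \<le> norm x * (2 / d)" for x
  proof (cases "x = 0")
    case False
    define r where "r = d / (2 * norm x)"
    have r: "r > 0" using d False by (simp add: r_def)
    have "norm (f (r *\<^sub>R x)) < 1" using d False by (intro d(2)) (simp add: r_def)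
    then have "r * norm (f x) < 1" using r by (simp add: scR)
    then show ?thesis using d False by (simp add: r_def field_simps)
  qed (simp add: f0)
  then show ?thesis by (intro bounded_linear_intro[of _ "2 / d"] add scR)
qed

lemma dualI:
  assumes "\<And>x y. f (x + y) = f x + f y" "\<And>c x. f (smul c x) = c * f x"
    "\<And>x. norm (f x) \<le> C * norm x"
  shows "f \<in> dual"
proof -
  have "bounded_linear f"
    using assms(1,3) assms(2)[of "of_real _"]
    by (intro bounded_linear_intro[of _ C]) (simp_all add: smul_of_real scaleR_conv_of_real mult.commute)
  then show ?thesis using assms by (simp add: dual_iff linear_continuous_on)
qed

lemma dual_zero: "0 \<in> dual"
  by (rule dualI[of _ 0]) auto

lemma dual_add: "f \<in> dual \<Longrightarrow> g \<in> dual \<Longrightarrow> f + g \<in> dual"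
  by (auto simp: dual_iff algebra_simps plus_fun_def intro: continuous_on_add)

lemma dual_scale: "f \<in> dual \<Longrightarrow> fun_scale c f \<in> dual"
  by (auto simp: dual_iff algebra_simps fun_scale_def intro: continuous_on_mult continuous_on_const)

lemma dual_diff: "f \<in> dual \<Longrightarrow> g \<in> dual \<Longrightarrow> f - g \<in> dual"
  by (auto simp: dual_iff algebra_simps fun_diff_def intro: continuous_on_diff)

lemma dual_sum: "(\<And>i. i \<in> I \<Longrightarrow> f i \<in> dual) \<Longrightarrow> sum f I \<in> dual"
  by (induction I rule: infinite_finite_induct) (auto simp: dual_zero dual_add)

lemma topspace_weak_star: "topspace weak_star = dual"
proof -
  have "\<Union>{{f \<in> dual. f x \<in> W} | x W. x \<in> topspace euclidean \<and> open W} = dual"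
  proof (rule Union_upper[THEN subset_antisym[rotated]])
    show "dual \<in> {{f \<in> dual. f x \<in> W} | x W. x \<in> topspace euclidean \<and> open W}"
      using open_UNIV by (intro CollectI exI[of _ 0] exI[of _ UNIV]) auto
  qed auto
  then show ?thesis by (simp add: weak_star_dual_def topology_generated_by_topspace)
qed

lemma openin_weak_star_eval: "open W \<Longrightarrow> openin weak_star {f \<in> dual. f x \<in> W}"
  unfolding weak_star_dual_def by (rule topology_generated_by_Basis) auto

section \<open>Annihilators of finite sets\<close>

lemma annihilator_nontrivial:
  assumes "finite F" "z \<notin> span F"
  shows "\<exists>g\<in>dual. (\<forall>x\<in>F. g x = 0) \<and> g z \<noteq> 0"
  using assms
proof (induction F arbitrary: z rule: finite_induct)
  case empty
  then show ?case using dual_separates by auto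
next
  case (insert a F)
  show ?case
  proof (cases "a \<in> span F")
    case True
    then have "span (insert a F) = span F" by (rule span_redundant)
    then obtain g where g: "g \<in> dual" "\<forall>x\<in>F. g x = 0" "g z \<noteq> 0"
      using insert.IH[of z] insert.prems by auto
    have "g a = 0"
      using True g(1,2)
      by (induction rule: span_induct_alt)
         (auto simp: dual_iff bounded_linear.linear[OF dual_bounded_linear[OF g(1)], THEN linear_0])
    then show ?thesis using g by auto
  next
    case False
    then obtain h0 where h0: "h0 \<in> dual" "\<forall>x\<in>F. h0 x = 0" "h0 a \<noteq> 0"
      using insert.IH[of a] by auto
    define h where "h = fun_scale (inverse (h0 a)) h0"
    have h: "h \<in> dual" "\<forall>x\<in>F. h x = 0" "h a = 1"
      using h0 dual_scale by (auto simp: h_def fun_scale_def)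
    \<comment> \<open>Here \<open>w\<close> has the same span membership as \<open>z\<close> modulo
      \<open>a\<close>. The functional \<open>g - fun_scale (g a) h\<close> vanishes on
      \<open>F\<close> and at \<open>a\<close>, since \<open>h a = 1\<close>, and its value at
      \<open>z\<close> is exactly \<open>g w\<close>.\<close>
    define w where "w = z - smul (h z) a"
    have "w \<notin> span F"
    proof
      assume "w \<in> span F"
      then have "w \<in> span (insert a F)" by (meson span_mono subset_iff subset_insertI)
      then have "w + smul (h z) a \<in> span (insert a F)"
        by (intro span_add span_scale) (auto intro: span_base)
      then show False using insert.prems by (simp add: w_def)
    qed
    then obtain g where g: "g \<in> dual" "\<forall>x\<in>F. g x = 0" "g w \<noteq> 0"
      using insert.IH[of w] by auto
    have "g w = g z - h z * g a"
      using g(1) by (simp add: w_def linear_diff[OF bounded_linear.linear[OF dual_bounded_linear]] dual_iff)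
    then show ?thesis
      using g h by (intro bexI[of _ "g - fun_scale (g a) h"] conjI dual_diff dual_scale)
        (auto simp: fun_scale_def)
  qed
qed

lemma infinite_dimensional_annihilator_nontrivial:
  assumes "infinite_dimensional smul" "finite F"
  obtains g where "g \<in> dual" "\<And>x. x \<in> F \<Longrightarrow> g x = 0" "g \<noteq> 0"
proof -
  obtain z where "z \<notin> span F" using assms unfolding infinite_dimensional_def by blast
  then obtain g where "g \<in> dual" "\<forall>x\<in>F. g x = 0" "g z \<noteq> 0"
    using annihilator_nontrivial[OF assms(2)] by blast
  then show ?thesis by (intro that[of g]) auto
qed

section \<open>Dual balls and their weak* compactness\<close>

definition dual_cball :: "real \<Rightarrow> ('e \<Rightarrow> 'k) set" where
  "dual_cball C = {f \<in> dual. \<forall>x. norm (f x) \<le> C * norm x}"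

text \<open>The norm bound implies continuity; what remains are conditions on single values, which
  are closed under pointwise limits.\<close>

lemma dual_cball_iff:
  "f \<in> dual_cball C \<longleftrightarrow> (\<forall>x y. f (x + y) = f x + f y) \<and> (\<forall>c x. f (smul c x) = c * f x) \<and>
     (\<forall>x. norm (f x) \<le> C * norm x)"
  using dualI[of f C] by (auto simp: dual_cball_def dual_iff)

lemma dual_cball_subset: "dual_cball C \<subseteq> dual"
  by (auto simp: dual_cball_def)

text \<open>Banach-Alaoglu: Tychonoff's theorem for a product of scalar balls, cut down by the
  closed linearity conditions. The topology is that of pointwise convergence on the function
  type.\<close>

lemma compact_dual_cball: "compact (dual_cball C)"
proof -
  have "compact (Pi\<^sub>E UNIV (\<lambda>x::'e. cball (0::'k) (C * norm x)))"
    using compactin_PiE[of "\<lambda>i::'e. euclidean :: 'k topology" UNIV "\<lambda>x. cball (0::'k) (C * norm x)"]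
    by (simp add: euclidean_product_topology)
  moreover have "closed {f :: 'e \<Rightarrow> 'k. (\<forall>x y. f (x + y) = f x + f y) \<and> (\<forall>c x. f (smul c x) = c * f x)}"
    by (intro closed_Collect_conj closed_Collect_all closed_Collect_eq continuous_intros)
       (auto intro: continuous_on_product_coordinates)
  ultimately have "compact (Pi\<^sub>E UNIV (\<lambda>x::'e. cball 0 (C * norm x)) \<inter>
      {f :: 'e \<Rightarrow> 'k. (\<forall>x y. f (x + y) = f x + f y) \<and> (\<forall>c x. f (smul c x) = c * f x)})"
    by (rule compact_Int_closed)
  also have "\<dots> = dual_cball C"
    by (auto simp: dual_cball_iff PiE_def Pi_def)
  finally show ?thesis .
qed

text \<open>Weak* compactness yields cluster points but not convergent subsequences. A cluster point
  still inherits every value that the sequence eventually takes at a point, which is all that the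
  gliding hump uses.\<close>

lemma dual_cball_cluster:
  assumes "\<And>m. s m \<in> dual_cball C"
  obtains g where "g \<in> dual_cball C"
    "\<And>x c. eventually (\<lambda>m. s m x = c) sequentially \<Longrightarrow> g x = c"
proof -
  define F where "F = filtermap s sequentially"
  have "F \<noteq> bot" by (simp add: F_def filtermap_bot_iff)
  moreover have "eventually (\<lambda>f. f \<in> dual_cball C) F"
    using assms by (simp add: F_def eventually_filtermap)
  ultimately obtain g where g: "g \<in> dual_cball C" "inf (nhds g) F \<noteq> bot"
    using compact_dual_cball[of C] unfolding compact_filter by blast
  show ?thesis
  proof (rule that[OF g(1)])
    fix x c assume "eventually (\<lambda>m. s m x = c) sequentially"
    \<comment> \<open>Along the nontrivial filter \<open>inf (nhds g) F\<close> the evaluation at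
      \<open>x\<close> tends both to \<open>g x\<close> and to \<open>c\<close>.\<close>
    then have ev: "eventually (\<lambda>f. f x = c) (inf (nhds g) F)"
      by (auto simp: F_def eventually_filtermap intro: filter_leD[OF inf_le2])
    have "((\<lambda>f. f x) \<longlongrightarrow> g x) (nhds g)"
      using continuous_on_product_coordinates[of x]
      by (metis UNIV_I continuous_on_def at_within_open open_UNIV tendsto_at_iff_tendsto_nhds)
    then have "((\<lambda>f. f x) \<longlongrightarrow> g x) (inf (nhds g) F)"
      by (rule tendsto_mono[rotated]) simp
    moreover have "((\<lambda>f. f x) \<longlongrightarrow> c) (inf (nhds g) F)"
      using ev by (rule tendsto_eventually)
    ultimately show "g x = c" using g(2) by (rule tendsto_unique[rotated])
  qed
qed

text \<open>This moves sets from the topology \<open>weak_star\<close> to the pointwise topology of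
  the ball, where compactness is available. The factor \<open>c\<close> is there because the Baire
  argument covers the ball by multiples of a barrel.\<close>

lemma openin_dual_cball_weak_star:
  assumes "openin weak_star U"
  shows "openin (top_of_set (dual_cball C)) {f \<in> dual_cball C. fun_scale c f \<in> U}"
proof -
  have "continuous_map (top_of_set (dual_cball C)) weak_star (fun_scale c)"
    unfolding weak_star_dual_def
  proof (rule continuous_on_generated_topo)
    fix U assume "U \<in> {{f \<in> dual. f x \<in> W} | x W. x \<in> topspace euclidean \<and> open W}"
    then obtain x W where U: "U = {f \<in> dual. f x \<in> W}" "open W" by auto
    have "continuous_on UNIV (\<lambda>f::'e\<Rightarrow>'k. c * f x)"
      by (intro continuous_intros continuous_on_product_coordinates)
    then have "open ((\<lambda>f::'e\<Rightarrow>'k. c * f x) -` W)"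
      using U(2) by (simp add: open_vimage)
    moreover have "fun_scale c -` U \<inter> topspace (top_of_set (dual_cball C)) =
        dual_cball C \<inter> ((\<lambda>f::'e\<Rightarrow>'k. c * f x) -` W)"
      using dual_cball_subset dual_scale by (auto simp: U fun_scale_def)
    ultimately show "openin (top_of_set (dual_cball C)) (fun_scale c -` U \<inter> topspace (top_of_set (dual_cball C)))"
      by (metis openin_open_Int)
  next
    have "\<Union>{{f \<in> dual. f x \<in> W} | x W. x \<in> topspace euclidean \<and> open W} = dual"
      using topspace_weak_star by (simp add: weak_star_dual_def topology_generated_by_topspace)
    then show "fun_scale c ` topspace (top_of_set (dual_cball C)) \<subseteq>
        \<Union>{{f \<in> dual. f x \<in> W} | x W. x \<in> topspace euclidean \<and> open W}"
      using dual_cball_subset[of C] dual_scale by (auto simp: subset_iff)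
  qed
  from openin_continuous_map_preimage[OF this assms] show ?thesis by simp
qed

lemma closedin_dual_cball_weak_star:
  assumes "closedin weak_star U"
  shows "closedin (top_of_set (dual_cball C)) {f \<in> dual_cball C. fun_scale c f \<in> U}"
proof -
  have "openin weak_star (dual - U)"
    using assms by (metis closedin_def topspace_weak_star)
  moreover have "dual_cball C - {f \<in> dual_cball C. fun_scale c f \<in> U} =
     {f \<in> dual_cball C. fun_scale c f \<in> dual - U}"
    using dual_cball_subset dual_scale by blast
  ultimately show ?thesis
    using openin_dual_cball_weak_star[of "dual - U" C c] by (auto simp: closedin_def)
qed

subsection \<open>Barrels in the weak* dual\<close>

text \<open>Baire's theorem in the weak* compact ball: some multiple of the barrel contains a nonempty
  relatively open subset of the ball, and small convex perturbations of its points towards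
  arbitrary points of the ball stay inside.\<close>

lemma barrel_absorbs_dual_cball:
  assumes bar: "barrel fun_scale weak_star U" and C: "0 \<le> C"
  obtains r where "r > 0" "\<And>f. f \<in> dual_cball C \<Longrightarrow> fun_scale (of_real r) f \<in> U"
proof -
  have clo: "closedin weak_star U" and ac: "absolutely_convex fun_scale U"
    and ab: "\<And>f. f \<in> dual \<Longrightarrow> \<exists>r>0. \<forall>c. norm c \<ge> r \<longrightarrow> f \<in> fun_scale c ` U"
    using bar by (auto simp: barrel_def absorbing_def topspace_weak_star)
  define X where "X = top_of_set (dual_cball C)"
  \<comment> \<open>These are the parts of the ball inside the multiples of \<open>U\<close> by
    \<open>Suc n\<close>; since \<open>U\<close> absorbs every point, they cover the ball.\<close>
  define T where "T n = {f \<in> dual_cball C. fun_scale (of_real (1 / real (Suc n))) f \<in> U}" for n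
  have "Hausdorff_space X"
    unfolding X_def by (metis Hausdorff_space_subtopology Hausdorff_space_product_topology
        Hausdorff_space_euclidean euclidean_product_topology)
  moreover have "compact_space X"
    unfolding X_def using compact_dual_cball by (simp add: compact_space_subtopology)
  ultimately have loc: "locally_compact_space X \<and> regular_space X"
    by (simp add: compact_imp_locally_compact_space compact_Hausdorff_imp_regular_space)
  have zero: "0 \<in> dual_cball C" using C dual_zero by (simp add: dual_cball_def)
  have "dual_cball C \<subseteq> \<Union>(range T)"
  proof
    fix f assume f: "f \<in> dual_cball C"
    then obtain r where r: "r > 0" "\<And>c. norm c \<ge> r \<Longrightarrow> f \<in> fun_scale c ` U"
      using ab dual_cball_subset by blast
    obtain n where n: "r < real n" using reals_Archimedean2 by blast
    have "r \<le> norm (of_real (real (Suc n)) :: 'k)"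
      unfolding norm_of_real using n by simp
    then have "f \<in> fun_scale (of_real (real (Suc n))) ` U"
      by (rule r(2))
    then obtain u where "u \<in> U" "f = fun_scale (of_real (real (Suc n))) u" by blast
    moreover have "of_real (1 / real (Suc n)) * of_real (real (Suc n)) = (1 :: 'k)"
      unfolding of_real_mult[symmetric] by simp
    ultimately have "fun_scale (of_real (1 / real (Suc n))) f \<in> U"
      by (simp only: fun_scale_def mult.assoc[symmetric] mult_1)
    then show "f \<in> \<Union>(range T)" using f by (auto simp: T_def)
  qed
  then have "\<Union>(range T) = topspace X" by (auto simp: X_def T_def)
  then have "X interior_of \<Union>(range T) \<noteq> {}"
    using zero interior_of_topspace[of X] by (auto simp: X_def)
  then obtain n where "X interior_of T n \<noteq> {}"
    using Baire_category_alt[of X "range T"] loc closedin_dual_cball_weak_star[OF clo]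
    by (auto simp: X_def T_def)
  then obtain f0 V where V: "openin X V" "f0 \<in> V" "V \<subseteq> T n"
    by (auto simp: interior_of_def)
  then obtain W where W: "open W" "V = dual_cball C \<inter> W"
    unfolding X_def openin_open by auto
  then obtain I \<delta> where I: "finite I" "\<delta> > 0" "\<And>g. (\<And>i. i \<in> I \<Longrightarrow> dist (g i) (f0 i) < \<delta>) \<Longrightarrow> g \<in> W"
    using open_fun_finite_dist[of W f0] V(2) by blast
  define M where "M = (\<Sum>i\<in>I. C * norm i)"
  have M: "C * norm i \<le> M" if "i \<in> I" for i
    unfolding M_def using that I(1) C by (intro member_le_sum) auto
  have M0: "0 \<le> M" unfolding M_def using C by (intro sum_nonneg) auto
  \<comment> \<open>On the coordinates in \<open>I\<close> two points of the ball differ by at most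
    \<open>2 * M\<close>, so a move by the fraction \<open>t\<close> stays within
    \<open>\<delta>\<close>. The summand 1 makes the inequality strict and avoids a zero
    denominator.\<close>
  define t where "t = min 1 (\<delta> / (1 + 2 * M))"
  have t: "0 < t" "t \<le> 1" using I(2) M0 by (auto simp: t_def)
  have "t \<le> \<delta> / (1 + 2 * M)" by (simp add: t_def)
  then have "t * (1 + 2 * M) \<le> \<delta>"
    using M0 by (subst (asm) pos_le_divide_eq) auto
  then have tM: "t * (2 * M) < \<delta>" using t by (simp add: algebra_simps)
  define c where "c = 1 / real (Suc n)"
  have c: "c > 0" by (simp add: c_def)
  have f0: "f0 \<in> dual_cball C" using V W by auto
  have cU: "fun_scale (of_real c) g \<in> U" if "g \<in> V" for g
    using that V(3) by (auto simp: T_def c_def)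
  have "fun_scale (of_real (c * t / 2)) f \<in> U" if f: "f \<in> dual_cball C" for f
  proof -
    define g where "g = fun_scale (of_real (1 - t)) f0 + fun_scale (of_real t) f"
    have nrm: "norm (f0 x) \<le> C * norm x" "norm (f x) \<le> C * norm x" for x
      using f0 f by (auto simp: dual_cball_def)
    have "g \<in> dual_cball C"
    proof -
      have "norm (g x) \<le> C * norm x" for x
      proof -
        have "norm (of_real (1 - t) :: 'k) = 1 - t" "norm (of_real t :: 'k) = t"
          unfolding norm_of_real using t by simp_all
        moreover have "norm (g x) \<le> norm (of_real (1 - t) * f0 x) + norm (of_real t * f x)"
          unfolding g_def fun_scale_def plus_fun_apply by (rule norm_triangle_ineq)
        ultimately have "norm (g x) \<le> (1 - t) * norm (f0 x) + t * norm (f x)"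
          by (simp only: norm_mult)
        also have "\<dots> \<le> (1 - t) * (C * norm x) + t * (C * norm x)"
          using t nrm by (intro add_mono mult_left_mono) auto
        finally show ?thesis by (simp add: algebra_simps)
      qed
      then show ?thesis
        using f f0 dual_cball_subset unfolding g_def
        by (auto simp: dual_cball_def intro!: dual_add dual_scale)
    qed
    moreover have "g \<in> W"
    proof (rule I(3))
      fix i assume i: "i \<in> I"
      have "g i - f0 i = of_real t * (f i - f0 i)"
        by (simp add: g_def fun_scale_def algebra_simps)
      then have "dist (g i) (f0 i) = t * norm (f i - f0 i)"
        using t by (simp add: dist_norm norm_mult)
      also have "\<dots> \<le> t * (2 * M)"
        using t nrm[of i] M[OF i] norm_triangle_ineq4[of "f i" "f0 i"] by (intro mult_left_mono) auto
      finally show "dist (g i) (f0 i) < \<delta>" using tM by simp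
    qed
    ultimately have "fun_scale (of_real c) g \<in> U" using W cU by auto
    moreover have "fun_scale (of_real c) f0 \<in> U" using V(2) cU by auto
    \<comment> \<open>These coefficients cancel the share of \<open>f0\<close> in \<open>g\<close>
      and leave a multiple of \<open>f\<close>; their norms add up to
      \<open>1 - t / 2\<close>.\<close>
    moreover have "norm (of_real (1/2) :: 'k) + norm (of_real (- (1 - t) / 2) :: 'k) \<le> 1"
      unfolding norm_of_real using t by (simp add: field_simps)
    ultimately have "fun_scale (of_real (1/2)) (fun_scale (of_real c) g) +
       fun_scale (of_real (- (1 - t) / 2)) (fun_scale (of_real c) f0) \<in> U"
      using ac unfolding absolutely_convex_def by blast
    also have "fun_scale (of_real (1/2)) (fun_scale (of_real c) g) +
       fun_scale (of_real (- (1 - t) / 2)) (fun_scale (of_real c) f0) = fun_scale (of_real (c * t / 2)) f"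
      by (auto simp: g_def fun_scale_def fun_eq_iff field_simps)
    finally show ?thesis .
  qed
  then show ?thesis using c t by (intro that[of "c * t / 2"]) auto
qed

lemma barrel_bounded_subset_dual_cball:
  assumes "B \<subseteq> dual_cball C" "0 \<le> C"
  shows "barrel_bounded fun_scale weak_star B"
  unfolding barrel_bounded_def
proof (intro conjI allI impI)
  show "B \<subseteq> topspace weak_star" using assms dual_cball_subset by (auto simp: topspace_weak_star)
  fix U assume bar: "barrel fun_scale weak_star U"
  then obtain r where r: "r > 0" "\<And>f. f \<in> dual_cball C \<Longrightarrow> fun_scale (of_real r) f \<in> U"
    using barrel_absorbs_dual_cball assms(2) by blast
  obtain n :: nat where n: "1 / r < real n" using reals_Archimedean2 by blast
  have n0: "n > 0" using n r by (cases n) (auto simp: field_simps)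
  have "B \<subseteq> fun_scale (of_nat n) ` U"
  proof
    fix f assume "f \<in> B"
    then have "fun_scale (of_real r) f \<in> U" using r assms by auto
    moreover have "norm (of_real (1 / (real n * r)) :: 'k) \<le> 1"
      unfolding norm_of_real using n r n0 by (simp add: field_simps)
    ultimately have "fun_scale (of_real (1 / (real n * r))) (fun_scale (of_real r) f) \<in> U"
      using bar absolutely_convex_scale unfolding barrel_def by blast
    moreover have "f = fun_scale (of_nat n) (fun_scale (of_real (1 / (real n * r))) (fun_scale (of_real r) f))"
      using r n0 by (simp add: fun_scale_def fun_eq_iff field_simps)
    ultimately show "f \<in> fun_scale (of_nat n) ` U" by blast
  qed
  then show "\<exists>n::nat. B \<subseteq> fun_scale (of_nat n) ` U" by blast
qed

lemma barrel_dual_cball: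
  assumes "C > 0"
  shows "barrel fun_scale weak_star (dual_cball C)"
  unfolding barrel_def
proof (intro conjI)
  show "closedin weak_star (dual_cball C)"
  proof -
    have "openin weak_star {f \<in> dual. f x \<in> - cball 0 (C * norm x)}" for x
      by (rule openin_weak_star_eval) (simp add: open_Compl)
    then have "openin weak_star (\<Union>x. {f \<in> dual. f x \<in> - cball 0 (C * norm x)})"
      by (intro openin_Union) blast
    moreover have "(\<Union>x. {f \<in> dual. f x \<in> - cball 0 (C * norm x)}) = dual - dual_cball C"
      by (auto simp: dual_cball_def)
    ultimately show ?thesis
      using dual_cball_subset by (auto simp: closedin_def topspace_weak_star)
  qed
  show "absolutely_convex fun_scale (dual_cball C)"
    unfolding absolutely_convex_def
  proof (intro ballI allI impI)
    fix f g and a b :: 'k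
    assume f: "f \<in> dual_cball C" and g: "g \<in> dual_cball C" and ab: "norm a + norm b \<le> 1"
    have "norm ((fun_scale a f + fun_scale b g) x) \<le> C * norm x" for x
    proof -
      have "norm ((fun_scale a f + fun_scale b g) x) \<le> norm a * norm (f x) + norm b * norm (g x)"
        by (auto simp: fun_scale_def norm_mult intro!: order_trans[OF norm_triangle_ineq])
      also have "\<dots> \<le> norm a * (C * norm x) + norm b * (C * norm x)"
        using f g by (intro add_mono mult_left_mono) (auto simp: dual_cball_def)
      also have "\<dots> \<le> 1 * (C * norm x)"
        unfolding distrib_right[symmetric] using ab assms by (intro mult_right_mono) auto
      finally show ?thesis by simp
    qed
    then show "fun_scale a f + fun_scale b g \<in> dual_cball C"
      using f g by (auto simp: dual_cball_def intro!: dual_add dual_scale)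
  qed
  show "absorbing fun_scale (topspace weak_star) (dual_cball C)"
    unfolding absorbing_def topspace_weak_star
  proof
    fix f assume f: "f \<in> dual"
    \<comment> \<open>The summand 1 keeps \<open>r\<close> positive even for \<open>f = 0\<close>,
      so that every admissible \<open>c\<close> is invertible.\<close>
    define r where "r = onorm f / C + 1"
    have bl: "bounded_linear f" using f by (rule dual_bounded_linear)
    have r: "r > 0" using onorm_pos_le[OF bl] assms by (simp add: r_def add_nonneg_pos)
    have "f \<in> fun_scale c ` dual_cball C" if c: "norm c \<ge> r" for c :: 'k
    proof
      have c0: "norm c > 0" "c \<noteq> 0" using c r by auto
      then show "f = fun_scale c (fun_scale (inverse c) f)" by (simp add: fun_scale_def fun_eq_iff)
      have "norm (f x) \<le> C * norm x * norm c" for x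
      proof -
        have "onorm f = C * (r - 1)" using assms by (simp add: r_def)
        also have "\<dots> \<le> C * norm c" using c assms by (intro mult_left_mono) auto
        finally have "onorm f * norm x \<le> C * norm c * norm x" by (rule mult_right_mono) auto
        then show ?thesis using onorm[OF bl, of x] by (simp add: mult_ac)
      qed
      then have "norm (fun_scale (inverse c) f x) \<le> C * norm x" for x
        using c0 by (simp add: fun_scale_def norm_mult norm_inverse norm_divide field_simps)
      then show "fun_scale (inverse c) f \<in> dual_cball C"
        using f by (simp add: dual_cball_def dual_scale)
    qed
    then show "\<exists>r>0. \<forall>c. norm c \<ge> r \<longrightarrow> f \<in> fun_scale c ` dual_cball C" using r by blast
  qed
qed

text \<open>Pigeonhole: if finitely many translates of the dual ball of radius
  \<open>\<epsilon> / 4\<close> covered the range, two of the functionals would share a centre and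
  differ by at most \<open>\<epsilon> / 2 * norm (y i)\<close> at \<open>y i\<close>.\<close>

lemma not_barrel_precompact_separated:
  assumes "\<And>i. y i \<noteq> 0" "\<epsilon> > 0"
    and sep: "\<And>i j. i < j \<Longrightarrow> norm (g i (y i) - g j (y i)) \<ge> \<epsilon> * norm (y i)"
  shows "\<not> barrel_precompact fun_scale weak_star (range (g :: nat \<Rightarrow> _))"
proof
  assume "barrel_precompact fun_scale weak_star (range g)"
  moreover have "barrel fun_scale weak_star (dual_cball (\<epsilon> / 4))"
    using assms(2) by (intro barrel_dual_cball) simp
  ultimately obtain F where F: "finite F" "range g \<subseteq> {x + u | x u. x \<in> F \<and> u \<in> dual_cball (\<epsilon> / 4)}"
    unfolding barrel_precompact_def by blast
  have "\<exists>x\<in>F. g i - x \<in> dual_cball (\<epsilon> / 4)" for i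
  proof -
    have "g i \<in> {x + u | x u. x \<in> F \<and> u \<in> dual_cball (\<epsilon> / 4)}" using F(2) by blast
    then obtain x u where "g i = x + u" "x \<in> F" "u \<in> dual_cball (\<epsilon> / 4)" by blast
    then show ?thesis by (intro bexI[of _ x]) simp_all
  qed
  then obtain x where x: "\<And>i. x i \<in> F" "\<And>i. g i - x i \<in> dual_cball (\<epsilon> / 4)" by metis
  have "\<not> inj x" using F(1) x(1) by (metis finite_subset image_subsetI infinite_UNIV_nat finite_imageD)
  then obtain i j where ij: "i < j" "x i = x j" by (metis injI linorder_neqE_nat)
  have "norm (g i (y i) - g j (y i)) \<le> norm ((g i - x i) (y i)) + norm ((g j - x j) (y i))"
    using ij norm_triangle_ineq4[of "(g i - x i) (y i)" "(g j - x j) (y i)"] by simp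
  also have "\<dots> \<le> \<epsilon> / 4 * norm (y i) + \<epsilon> / 4 * norm (y i)"
    using x(2)[of i] x(2)[of j] unfolding dual_cball_def by (intro add_mono) blast+
  also have "\<dots> < \<epsilon> * norm (y i)" using assms(1,2) by simp
  finally show False using sep[OF ij(1)] by simp
qed

subsection \<open>Null sequences in the bidual\<close>

abbreviation bidual :: "(('e \<Rightarrow> 'k) \<Rightarrow> 'k) set" where
  "bidual \<equiv> topological_dual fun_scale weak_star"

lemma bidual_add: "\<phi> \<in> bidual \<Longrightarrow> f \<in> dual \<Longrightarrow> g \<in> dual \<Longrightarrow> \<phi> (f + g) = \<phi> f + \<phi> g"
  by (simp add: topological_dual_def[of fun_scale] topspace_weak_star)

lemma bidual_scale: "\<phi> \<in> bidual \<Longrightarrow> f \<in> dual \<Longrightarrow> \<phi> (fun_scale c f) = c * \<phi> f"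
  by (simp add: topological_dual_def[of fun_scale] topspace_weak_star)

lemma bidual_zero:
  assumes "\<phi> \<in> bidual"
  shows "\<phi> 0 = 0"
  using bidual_add[OF assms dual_zero dual_zero] by simp

lemma bidual_sum:
  "\<phi> \<in> bidual \<Longrightarrow> (\<And>i. i \<in> I \<Longrightarrow> f i \<in> dual) \<Longrightarrow> \<phi> (sum f I) = (\<Sum>i\<in>I. \<phi> (f i))"
  by (induction I rule: infinite_finite_induct) (auto simp: bidual_zero bidual_add dual_sum)

text \<open>Each generating set looks at one point, and finite intersections and unions keep the
  number of points finite; hence the induction over the generation of the topology.\<close>

lemma openin_weak_star_finite_agreement:
  assumes "openin weak_star U" "g \<in> U"
  shows "\<exists>A. finite A \<and> (\<forall>f\<in>dual. (\<forall>a\<in>A. f a = g a) \<longrightarrow> f \<in> U)"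
proof -
  have "generate_topology_on {{f \<in> dual. f x \<in> W} | x W. x \<in> topspace euclidean \<and> open W} U"
    using assms(1) unfolding weak_star_dual_def by (rule openin_topology_generated_by)
  then show ?thesis
    using assms(2)
  proof induction
    case Empty
    then show ?case by simp
  next
    case (Int a b)
    then obtain A B where "finite A" "\<forall>f\<in>dual. (\<forall>a\<in>A. f a = g a) \<longrightarrow> f \<in> a"
      "finite B" "\<forall>f\<in>dual. (\<forall>a\<in>B. f a = g a) \<longrightarrow> f \<in> b" by blast
    then show ?case by (intro exI[of _ "A \<union> B"]) auto
  next
    case (UN K)
    then obtain k where k: "k \<in> K" "g \<in> k" by blast
    then obtain A where "finite A" "\<forall>f\<in>dual. (\<forall>a\<in>A. f a = g a) \<longrightarrow> f \<in> k"
      using UN.IH by metis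
    then show ?case using k(1) by (intro exI[of _ A]) auto
  next
    case (Basis s)
    then obtain x W where "s = {f \<in> dual. f x \<in> W}" by blast
    then show ?case using Basis by (intro exI[of _ "{x}"]) auto
  qed
qed

text \<open>Continuity at zero bounds \<open>\<phi>\<close> by one on the annihilator of a finite
  set. That annihilator is a subspace, so homogeneity forces \<open>\<phi>\<close> to vanish on
  it.\<close>

lemma bidual_finite_support:
  assumes \<phi>: "\<phi> \<in> bidual"
  obtains A where "finite A" "\<And>f. f \<in> dual \<Longrightarrow> (\<And>a. a \<in> A \<Longrightarrow> f a = 0) \<Longrightarrow> \<phi> f = 0"
proof -
  have "continuous_map weak_star euclidean \<phi>"
    using \<phi> by (simp add: topological_dual_def[of fun_scale])
  then have "openin weak_star {f \<in> dual. \<phi> f \<in> ball 0 1}"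
    using openin_continuous_map_preimage[of weak_star euclidean \<phi> "ball 0 1"]
    by (simp add: topspace_weak_star)
  then obtain A where A: "finite A"
    "\<And>f. f \<in> dual \<Longrightarrow> (\<forall>a\<in>A. f a = 0 a) \<Longrightarrow> f \<in> {f \<in> dual. \<phi> f \<in> ball 0 1}"
    using openin_weak_star_finite_agreement[of _ 0] bidual_zero[OF \<phi>] dual_zero
    by (metis (no_types, lifting) centre_in_ball mem_Collect_eq zero_less_one)
  show ?thesis
  proof (rule that[OF A(1)], rule ccontr)
    fix f assume f: "f \<in> dual" "\<And>a. a \<in> A \<Longrightarrow> f a = 0" "\<phi> f \<noteq> 0"
    \<comment> \<open>The rescaled functional still vanishes on \<open>A\<close>, yet
      \<open>\<phi>\<close> takes the value 1 on it, outside the open unit ball.\<close>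
    have "fun_scale (inverse (\<phi> f)) f \<in> {f \<in> dual. \<phi> f \<in> ball 0 1}"
      using f by (intro A(2) dual_scale) (auto simp: fun_scale_def)
    then show False using f by (simp add: bidual_scale[OF \<phi>])
  qed
qed

lemma bidual_limitin_zero:
  assumes lim: "limitin (weak_star_dual fun_scale weak_star) \<phi> 0 sequentially" and f: "f \<in> dual"
  shows "(\<lambda>n. \<phi> n f) \<longlonglongrightarrow> 0"
proof (rule topological_tendstoI)
  fix W :: "'k set" assume W: "open W" "0 \<in> W"
  have top: "topspace (weak_star_dual fun_scale weak_star) \<subseteq> bidual"
    unfolding weak_star_dual_def[of fun_scale] topology_generated_by_topspace by blast
  have "openin (weak_star_dual fun_scale weak_star) {\<psi> \<in> bidual. \<psi> f \<in> W}"
    unfolding weak_star_dual_def[of fun_scale] using f W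
    by (intro topology_generated_by_Basis) (auto simp: topspace_weak_star)
  moreover have "0 \<in> {\<psi> \<in> bidual. \<psi> f \<in> W}"
    using lim top W by (auto simp: limitin_def)
  ultimately have "eventually (\<lambda>n. \<phi> n \<in> {\<psi> \<in> bidual. \<psi> f \<in> W}) sequentially"
    using lim unfolding limitin_def by blast
  then show "eventually (\<lambda>n. \<phi> n f \<in> W) sequentially" by eventually_elim simp
qed

text \<open>Each \<open>g k\<close> vanishes at points where the earlier functionals exceed half
  their norm; this separates them. The bounds \<open>inverse (real (Suc k))\<close> hold for all
  \<open>n\<close> at once, so uniform smallness on the range comes down to finitely many
  \<open>k\<close>.\<close>

lemma separated_null_sequence:
  assumes \<phi>: "\<And>n. \<phi> n \<in> bidual" and null: "\<And>f. f \<in> dual \<Longrightarrow> (\<lambda>n. \<phi> n f) \<longlonglongrightarrow> 0"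
    and small: "\<And>F \<epsilon>. finite F \<Longrightarrow> \<epsilon> > 0 \<Longrightarrow>
      \<exists>g\<in>dual. (\<forall>x\<in>F. g x = 0) \<and> onorm g = 1 \<and> (\<forall>n. norm (\<phi> n g) \<le> \<epsilon>)"
  obtains B where "barrel_bounded fun_scale weak_star B" "\<not> barrel_precompact fun_scale weak_star B"
    "(\<lambda>n. sup_on (\<phi> n) B) \<longlonglongrightarrow> 0"
proof -
  have "\<forall>k F. \<exists>g. finite F \<longrightarrow> g \<in> dual \<and> (\<forall>x\<in>F. g x = 0) \<and> onorm g = 1 \<and>
      (\<forall>n. norm (\<phi> n g) \<le> inverse (real (Suc k)))"
    using small by (metis inverse_positive_iff_positive of_nat_0_less_iff zero_less_Suc)
  then obtain G where G: "\<And>k F. finite F \<Longrightarrow> G k F \<in> dual"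
      "\<And>k F x. finite F \<Longrightarrow> x \<in> F \<Longrightarrow> G k F x = 0" "\<And>k F. finite F \<Longrightarrow> onorm (G k F) = 1"
      "\<And>k F n. finite F \<Longrightarrow> norm (\<phi> n (G k F)) \<le> inverse (real (Suc k))"
    by metis
  \<comment> \<open>The strict inequality also forces the witness to be nonzero.\<close>
  have "\<exists>y. norm (g y) > 1 / 2 * norm y" if "onorm g = 1" for g :: "'e \<Rightarrow> 'k"
  proof (rule ccontr)
    assume "\<not> ?thesis"
    then have "onorm g \<le> 1 / 2" by (intro onorm_bound) (auto simp: not_less)
    then show False using that by simp
  qed
  then obtain Y where Y: "\<And>g :: 'e \<Rightarrow> 'k. onorm g = 1 \<Longrightarrow> norm (g (Y g)) > 1 / 2 * norm (Y g)" by metis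
  \<comment> \<open>\<open>F k\<close> collects the witnesses of \<open>g 0\<close> up to
    \<open>g (k - 1)\<close>.\<close>
  define F where "F = rec_nat {} (\<lambda>k F. insert (Y (G k F)) F)"
  define g where "g k = G k (F k)" for k
  have F: "F 0 = {}" "F (Suc k) = insert (Y (g k)) (F k)" for k
    by (simp_all add: F_def g_def)
  have fin: "finite (F k)" for k by (induction k) (simp_all add: F)
  have mem: "i < k \<Longrightarrow> Y (g i) \<in> F k" for i k
    by (induction k) (auto simp: F less_Suc_eq)
  have g: "g k \<in> dual" "onorm (g k) = 1" "norm (\<phi> n (g k)) \<le> inverse (real (Suc k))" for k n
    using G(1,3,4)[OF fin] by (simp_all add: g_def del: of_nat_Suc)
  have gY: "g k (Y (g i)) = 0" if "i < k" for i k
    using G(2)[OF fin mem[OF that]] by (simp add: g_def)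
  have ball: "range g \<subseteq> dual_cball 1"
    using g(1,2) onorm[OF dual_bounded_linear] by (fastforce simp: dual_cball_def)
  show ?thesis
  proof (rule that)
    show "barrel_bounded fun_scale weak_star (range g)"
      using ball by (rule barrel_bounded_subset_dual_cball) simp
    show "\<not> barrel_precompact fun_scale weak_star (range g)"
    proof (rule not_barrel_precompact_separated)
      fix i
      show "Y (g i) \<noteq> 0"
        using Y[OF g(2), of i] linear_0[OF bounded_linear.linear[OF dual_bounded_linear[OF g(1)]], of i]
        by auto
      show "norm (g i (Y (g i)) - g j (Y (g i))) \<ge> 1 / 2 * norm (Y (g i))" if "i < j" for j
        using Y[OF g(2), of i] gY[OF that] by simp
    qed simp
    show "(\<lambda>n. sup_on (\<phi> n) (range g)) \<longlonglongrightarrow> 0"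
    proof (rule sup_on_tendsto_zero)
      fix e :: real assume e: "e > 0"
      then obtain K where K: "inverse (real (Suc K)) < e" using reals_Archimedean by blast
      have "eventually (\<lambda>n. \<forall>k\<in>{..<K}. norm (\<phi> n (g k)) < e) sequentially"
        using null[OF g(1)] e by (intro eventually_ball_finite ballI) (auto simp: tendsto_iff)
      then show "eventually (\<lambda>n. \<forall>f\<in>range g \<union> {0}. norm (\<phi> n f) \<le> e) sequentially"
      proof eventually_elim
        case (elim n)
        have "norm (\<phi> n (g k)) \<le> e" for k
        proof (cases "k < K")
          case True
          then show ?thesis using elim by (simp add: less_imp_le)
        next
          case False
          then have "inverse (real (Suc k)) \<le> inverse (real (Suc K))"
            by (intro le_imp_inverse_le) auto
          then show ?thesis using g(3)[of n k] K by linarith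
        qed
        then show ?case using e bidual_zero[OF \<phi>] by auto
      qed
    qed
  qed
qed

text \<open>The hypothesis \<open>large\<close> says that \<open>g \<mapsto> (\<phi> n g)\<close> is
  bounded below by \<open>\<epsilon>\<close> on the unit sphere of the annihilator of
  \<open>F\<close>; normalising \<open>g\<close> turns this into a norm estimate.\<close>

lemma dual_cball_of_bidual_bound:
  assumes \<phi>: "\<And>n. \<phi> n \<in> bidual" and \<epsilon>: "\<epsilon> > 0"
    and large: "\<And>g. g \<in> dual \<Longrightarrow> (\<And>x. x \<in> F \<Longrightarrow> g x = 0) \<Longrightarrow> onorm g = 1 \<Longrightarrow> \<exists>n. norm (\<phi> n g) > \<epsilon>"
    and g: "g \<in> dual" "\<And>x. x \<in> F \<Longrightarrow> g x = 0" and bound: "\<And>n. norm (\<phi> n g) \<le> c"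
  shows "g \<in> dual_cball (c / \<epsilon>)"
proof -
  have bl: "bounded_linear g" by (rule dual_bounded_linear[OF g(1)])
  have c: "0 \<le> c" using norm_ge_zero bound by (rule order_trans)
  have "onorm g \<le> c / \<epsilon>"
  proof (rule ccontr)
    assume "\<not> onorm g \<le> c / \<epsilon>"
    then have gt: "onorm g > c / \<epsilon>" by simp
    then have pos: "onorm g > 0" using divide_nonneg_pos[OF c \<epsilon>] by linarith
    define h where "h = fun_scale (of_real (inverse (onorm g))) g"
    have "h = (\<lambda>x. inverse (onorm g) *\<^sub>R g x)"
      by (simp add: h_def fun_scale_def scaleR_conv_of_real)
    then have "onorm h = 1" using onorm_scaleR[OF bl, of "inverse (onorm g)"] pos by simp
    moreover have "h \<in> dual" using g by (simp add: h_def dual_scale)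
    ultimately obtain n where "norm (\<phi> n h) > \<epsilon>"
      using large[of h] g(2) by (auto simp: h_def fun_scale_def)
    then have "norm (\<phi> n g) > \<epsilon> * onorm g"
      using pos by (simp add: h_def bidual_scale[OF \<phi> g(1)] norm_mult norm_inverse field_simps norm_divide)
    moreover have "\<epsilon> * onorm g > c" using gt \<epsilon> by (simp add: field_simps)
    ultimately show False using bound[of n] by simp
  qed
  then have "norm (g x) \<le> c / \<epsilon> * norm x" for x
    using onorm[OF bl, of x] by (meson mult_right_mono norm_ge_zero order_trans)
  then show ?thesis using g by (simp add: dual_cball_def)
qed

text \<open>Infinite dimension leaves a nonzero functional \<open>h\<close> vanishing on
  \<open>A \<union> F\<close>. The sequence \<open>\<phi> n h\<close> is null and not identically
  zero, so it attains its largest norm, and dividing by that entry produces a peak of height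
  one.\<close>

lemma peak_functional:
  assumes inf: "infinite_dimensional smul"
    and \<phi>: "\<And>n. \<phi> n \<in> bidual" and null: "\<And>f. f \<in> dual \<Longrightarrow> (\<lambda>n. \<phi> n f) \<longlonglongrightarrow> 0"
    and F: "finite F" and \<epsilon>: "\<epsilon> > 0"
    and large: "\<And>g. g \<in> dual \<Longrightarrow> (\<And>x. x \<in> F \<Longrightarrow> g x = 0) \<Longrightarrow> onorm g = 1 \<Longrightarrow> \<exists>n. norm (\<phi> n g) > \<epsilon>"
    and A: "finite A"
  shows "\<exists>g\<in>dual. (\<forall>x\<in>A \<union> F. g x = 0) \<and> (\<forall>n. norm (\<phi> n g) \<le> 1) \<and> (\<exists>n. norm (\<phi> n g) = 1)"
proof -
  obtain h where h: "h \<in> dual" "\<And>x. x \<in> A \<union> F \<Longrightarrow> h x = 0" "h \<noteq> 0"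
    using infinite_dimensional_annihilator_nontrivial[OF inf, of "A \<union> F"] F A by blast
  have "\<exists>n. norm (\<phi> n h) > 0"
  proof (rule ccontr)
    assume "\<not> ?thesis"
    \<comment> \<open>With the bound 0 the norm estimate becomes injectivity on the annihilator of
      \<open>F\<close>.\<close>
    then have "h \<in> dual_cball (0 / \<epsilon>)"
      using h by (intro dual_cball_of_bidual_bound[OF \<phi> \<epsilon> large]) auto
    then show False using h(3) by (auto simp: dual_cball_def fun_eq_iff)
  qed
  then obtain n0 where "norm (\<phi> n0 h) > 0" by blast
  then obtain m where m: "\<And>n. norm (\<phi> n h) \<le> norm (\<phi> m h)" "norm (\<phi> m h) > 0"
    using null_sequence_attains_max[of "\<lambda>n. norm (\<phi> n h)" n0] tendsto_norm_zero[OF null[OF h(1)]]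
    by metis
  define g where "g = fun_scale (inverse (\<phi> m h)) h"
  have ng: "norm (\<phi> n g) = norm (\<phi> n h) / norm (\<phi> m h)" for n
    by (simp add: g_def bidual_scale[OF \<phi> h(1)] norm_mult norm_inverse norm_divide field_simps)
  show ?thesis
  proof (intro bexI[of _ g] conjI)
    show "\<forall>x\<in>A \<union> F. g x = 0" using h(2) by (simp add: g_def fun_scale_def)
    show "\<forall>n. norm (\<phi> n g) \<le> 1" using m by (simp add: ng)
    show "\<exists>n. norm (\<phi> n g) = 1" using m(2) by (intro exI[of _ m]) (simp add: ng)
    show "g \<in> dual" using h by (simp add: g_def dual_scale)
  qed
qed

text \<open>A gliding hump. The normalised functionals \<open>g k\<close> peak on disjoint blocks of indices, so
  their partial sums are bounded; at the peaks a weak* cluster point of the partial sums is bounded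
  away from zero.\<close>

lemma exists_unit_functional_nearly_null:
  assumes inf: "infinite_dimensional smul"
    and \<phi>: "\<And>n. \<phi> n \<in> bidual" and null: "\<And>f. f \<in> dual \<Longrightarrow> (\<lambda>n. \<phi> n f) \<longlonglongrightarrow> 0"
    and F: "finite F" and \<epsilon>: "\<epsilon> > 0"
  shows "\<exists>g\<in>dual. (\<forall>x\<in>F. g x = 0) \<and> onorm g = 1 \<and> (\<forall>n. norm (\<phi> n g) \<le> \<epsilon>)"
proof (rule ccontr)
  assume "\<not> ?thesis"
  then have large: "\<exists>n. norm (\<phi> n g) > \<epsilon>"
    if "g \<in> dual" "\<And>x. x \<in> F \<Longrightarrow> g x = 0" "onorm g = 1" for g
    using that by (meson not_le)
  obtain S where S: "\<And>n. finite (S n)" "\<And>n f. f \<in> dual \<Longrightarrow> (\<And>a. a \<in> S n \<Longrightarrow> f a = 0) \<Longrightarrow> \<phi> n f = 0"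
  proof -
    have "\<exists>A. finite A \<and> (\<forall>f\<in>dual. (\<forall>a\<in>A. f a = 0) \<longrightarrow> \<phi> n f = 0)" for n
      by (rule bidual_finite_support[OF \<phi>[of n]]) blast
    then show ?thesis using that by metis
  qed
  have "\<exists>g\<in>dual. (\<forall>x\<in>A \<union> F. g x = 0) \<and> (\<forall>n. norm (\<phi> n g) \<le> 1) \<and> (\<exists>n. norm (\<phi> n g) = 1)"
    if "finite A" for A
    using inf \<phi> null F \<epsilon> large that by (rule peak_functional)
  then obtain G where G: "\<And>A. finite A \<Longrightarrow> G A \<in> dual" "\<And>A x. finite A \<Longrightarrow> x \<in> A \<union> F \<Longrightarrow> G A x = 0"
    "\<And>A n. finite A \<Longrightarrow> norm (\<phi> n (G A)) \<le> 1" "\<And>A. finite A \<Longrightarrow> \<exists>n. norm (\<phi> n (G A)) = 1"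
    by metis
  have "\<exists>M. \<forall>n\<ge>M. norm (\<phi> n g) \<le> (1/4) * (1/2) ^ k" if "g \<in> dual" for g and k :: nat
  proof -
    have "eventually (\<lambda>n. norm (\<phi> n g) < (1/4) * (1/2) ^ k) sequentially"
      by (rule order_tendstoD(2)[OF tendsto_norm_zero[OF null[OF that]]]) simp
    then show ?thesis by (auto simp: eventually_sequentially intro: less_imp_le)
  qed
  then obtain M where M: "\<And>g k n. g \<in> dual \<Longrightarrow> n \<ge> M g k \<Longrightarrow> norm (\<phi> n g) \<le> (1/4) * (1/2) ^ k"
    by metis
  \<comment> \<open>A functional in the dual that vanishes on \<open>A n\<close> is annihilated by
    \<open>\<phi> i\<close> for all \<open>i < n\<close>.\<close>
  define A where "A n = (\<Union>i<n. S i)" for n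
  have finA: "finite (A n)" for n using S(1) by (simp add: A_def)
  \<comment> \<open>Block \<open>k\<close> consists of the indices from \<open>N k\<close> up to but
    excluding \<open>N (Suc k)\<close>: before it \<open>\<phi> n (g k)\<close> is zero, after it at
    most \<open>(1/4) * (1/2) ^ k\<close>.\<close>
  define N where "N = rec_nat 0 (\<lambda>k n. n + M (G (A n)) k)"
  define g where "g k = G (A (N k))" for k
  have N_Suc: "N (Suc k) = N k + M (g k) k" for k
    by (simp add: N_def g_def)
  have N0: "N 0 = 0" by (simp add: N_def)
  have g_dual: "g k \<in> dual" and g_A: "x \<in> A (N k) \<Longrightarrow> g k x = 0" and g_F: "x \<in> F \<Longrightarrow> g k x = 0"
    and g_le: "norm (\<phi> n (g k)) \<le> 1" and g_peak: "\<exists>n. norm (\<phi> n (g k)) = 1" for k n x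
    using G[OF finA] by (auto simp: g_def)
  have g_before: "\<phi> n (g k) = 0" if "n < N k" for n k
    using that by (intro S(2) g_dual g_A) (auto simp: A_def)
  have g_after: "norm (\<phi> n (g k)) \<le> (1/4) * (1/2) ^ k" if "N (Suc k) \<le> n" for n k
    using that by (intro M g_dual) (simp add: N_Suc)
  obtain p where p: "\<And>k. norm (\<phi> (p k) (g k)) = 1" using g_peak by metis
  have p_ge: "N k \<le> p k" for k
    using g_before[of "p k" k] p[of k] by (cases "p k < N k") auto
  have p_less: "p k < N (Suc k)" for k
  proof (rule ccontr)
    assume "\<not> ?thesis"
    then have "1 \<le> (1/4) * (1/2 :: real) ^ k" using g_after[of k "p k"] p[of k] by simp
    moreover have "(1/2 :: real) ^ k \<le> 1" by (simp add: power_le_one)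
    ultimately show False by simp
  qed
  have "strict_mono N"
    unfolding strict_mono_Suc_iff using p_ge p_less le_less_trans by blast
  then have N_ge: "k \<le> N k" and N_mono: "i \<le> j \<Longrightarrow> N i \<le> N j" for k i j
    by (auto simp: strict_mono_imp_increasing strict_mono_leD)
  have off_peak: "norm (\<phi> n (g k)) \<le> (1/4) * (1/2) ^ k" if "N j \<le> n" "n < N (Suc j)" "k \<noteq> j" for n j k
  proof (cases "k < j")
    case True
    then have "N (Suc k) \<le> N j" by (intro N_mono) simp
    then show ?thesis using that by (intro g_after) simp
  next
    case False
    then have "N (Suc j) \<le> N k" using that by (intro N_mono) simp
    then show ?thesis using that g_before[of n k] by simp
  qed
  have off_sum: "(\<Sum>k\<in>{..<m} - {j}. norm (\<phi> n (g k))) \<le> 1/2" if "N j \<le> n" "n < N (Suc j)" for n j m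
  proof -
    have "(\<Sum>k\<in>{..<m} - {j}. norm (\<phi> n (g k))) \<le> (\<Sum>k\<in>{..<m} - {j}. (1/4) * (1/2) ^ k)"
      using off_peak[OF that] by (intro sum_mono) auto
    also have "\<dots> \<le> (\<Sum>k<m. (1/4) * (1/2) ^ k)" by (intro sum_mono2) auto
    also have "\<dots> \<le> 1/2" unfolding sum_quarter_geometric by simp
    finally show ?thesis .
  qed
  define s where "s m = (\<Sum>k<m. g k)" for m
  have s_dual: "s m \<in> dual" for m unfolding s_def by (intro dual_sum g_dual)
  have \<phi>_s: "\<phi> n (s m) = (\<Sum>k<m. \<phi> n (g k))" for n m
    unfolding s_def by (intro bidual_sum \<phi> g_dual)
  have s_F: "s m x = 0" if "x \<in> F" for m x
    using g_F[OF that] by (simp add: s_def sum_fun_eval)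
  have s_bound: "norm (\<phi> n (s m)) \<le> 3/2" for n m
  proof -
    \<comment> \<open>As \<open>N 0 = 0\<close>, this least \<open>k\<close> is a successor
      \<open>Suc j\<close>, and \<open>j\<close> is the block containing \<open>n\<close>.\<close>
    define k where "k = (LEAST k. n < N k)"
    have "n < N (Suc n)" using N_ge[of "Suc n"] by simp
    then have k: "n < N k" unfolding k_def by (rule LeastI)
    then obtain j where j: "k = Suc j" using N0 by (cases k) auto
    then have "\<not> n < N j" unfolding k_def by (intro not_less_Least) simp
    then have "N j \<le> n" "n < N (Suc j)" using k j by auto
    note off = off_sum[OF this, of m]
    have "norm (\<phi> n (s m)) \<le> (\<Sum>k<m. norm (\<phi> n (g k)))" unfolding \<phi>_s by (rule norm_sum)
    \<comment> \<open>Inserting \<open>j\<close> may enlarge the index set, since \<open>j\<close>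
      can be at least \<open>m\<close>.\<close>
    also have "\<dots> \<le> (\<Sum>k\<in>insert j ({..<m} - {j}). norm (\<phi> n (g k)))" by (intro sum_mono2) auto
    also have "\<dots> = norm (\<phi> n (g j)) + (\<Sum>k\<in>{..<m} - {j}. norm (\<phi> n (g k)))"
      by (rule sum.insert) auto
    finally show ?thesis using off g_le[of n j] by simp
  qed
  have s_ball: "s m \<in> dual_cball (3/2 / \<epsilon>)" for m
    using \<phi> \<epsilon> large s_dual s_F s_bound by (rule dual_cball_of_bidual_bound)
  obtain u where u: "u \<in> dual_cball (3/2 / \<epsilon>)"
    "\<And>x c. eventually (\<lambda>m. s m x = c) sequentially \<Longrightarrow> u x = c"
    using dual_cball_cluster[of s, OF s_ball] by blast
  then have u_dual: "u \<in> dual" using dual_cball_subset by blast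
  have \<phi>_u: "\<phi> n u = (\<Sum>k<Suc n. \<phi> n (g k))" for n
  proof -
    \<comment> \<open>For \<open>k > n\<close> the functional \<open>g k\<close> vanishes on
      \<open>S n\<close>, so the partial sums are constant there from \<open>Suc n\<close> on and
      the cluster point takes the same values. Thus \<open>\<phi> n u\<close> is a finite sum
      although \<open>u\<close> is only a cluster point.\<close>
    have "u a = s (Suc n) a" if a: "a \<in> S n" for a
    proof (rule u(2))
      have "g k a = 0" if "n < k" for k
      proof -
        have "n < N k" using that N_ge[of k] by simp
        then show ?thesis using a by (intro g_A) (auto simp: A_def)
      qed
      then have "s m a = s (Suc n) a" if "Suc n \<le> m" for m
        unfolding s_def sum_fun_eval using that by (intro sum.mono_neutral_right) auto
      then show "eventually (\<lambda>m. s m a = s (Suc n) a) sequentially"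
        unfolding eventually_sequentially by blast
    qed
    then have "\<phi> n (u - s (Suc n)) = 0"
      by (intro S(2) dual_diff u_dual s_dual) simp
    then have "\<phi> n (u - s (Suc n) + s (Suc n)) = \<phi> n (s (Suc n))"
      by (subst bidual_add[OF \<phi> dual_diff[OF u_dual s_dual] s_dual]) simp
    then show ?thesis by (simp only: \<phi>_s diff_add_cancel)
  qed
  have "norm (\<phi> (p j) u) \<ge> 1/2" for j
  proof -
    \<comment> \<open>This puts the peak term of norm one into the sum; the other terms contribute
      at most 1/2 in norm.\<close>
    have "j < Suc (p j)" using N_ge[of j] p_ge[of j] by simp
    then have split: "\<phi> (p j) u = \<phi> (p j) (g j) + (\<Sum>k\<in>{..<Suc (p j)} - {j}. \<phi> (p j) (g k))"
      unfolding \<phi>_u by (intro sum.remove) auto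
    have "norm (\<Sum>k\<in>{..<Suc (p j)} - {j}. \<phi> (p j) (g k)) \<le> 1/2"
      by (rule order_trans[OF norm_sum off_sum[OF p_ge p_less]])
    then show ?thesis
      unfolding split using p[of j] norm_diff_ineq[of "\<phi> (p j) (g j)" "\<Sum>k\<in>{..<Suc (p j)} - {j}. \<phi> (p j) (g k)"]
      by linarith
  qed
  moreover have "eventually (\<lambda>n. norm (\<phi> n u) < 1/2) sequentially"
    by (rule order_tendstoD(2)[OF tendsto_norm_zero[OF null[OF u_dual]]]) simp
  then obtain K where "\<And>n. n \<ge> K \<Longrightarrow> norm (\<phi> n u) < 1/2" by (auto simp: eventually_sequentially)
  moreover have "K \<le> p K" using N_ge p_ge le_trans by blast
  ultimately show False by (meson not_le)
qed

theorem not_strong_gelfand_phillips: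
  assumes "infinite_dimensional smul"
  shows "\<not> strong_gelfand_phillips fun_scale weak_star"
proof
  assume "strong_gelfand_phillips fun_scale weak_star"
  then obtain \<phi> where \<phi>: "\<And>n. \<phi> n \<in> bidual"
      "limitin (weak_star_dual fun_scale weak_star) \<phi> 0 sequentially"
    and GP: "\<And>B. barrel_bounded fun_scale weak_star B \<Longrightarrow> \<not> barrel_precompact fun_scale weak_star B \<Longrightarrow>
      \<not> (\<lambda>n. sup_on (\<phi> n) B) \<longlonglongrightarrow> 0"
    unfolding strong_gelfand_phillips_def by blast
  have null: "(\<lambda>n. \<phi> n f) \<longlonglongrightarrow> 0" if "f \<in> dual" for f
    using bidual_limitin_zero[OF \<phi>(2) that] .
  show False
    using separated_null_sequence[OF \<phi>(1) null exists_unit_functional_nearly_null[OF assms \<phi>(1) null]] GP by metis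
qed

end

subsection \<open>Real and complex scalars\<close>

lemma normed_space_separating_dual_real:
  "normed_space_separating_dual ((*\<^sub>R) :: real \<Rightarrow> 'a::real_normed_vector \<Rightarrow> 'a)"
proof (intro normed_space_separating_dual.intro normed_space_separating_dual_axioms.intro)
  show "vector_space ((*\<^sub>R) :: real \<Rightarrow> 'a \<Rightarrow> 'a)"
    by unfold_locales (auto simp: algebra_simps)
  fix z :: 'a assume "z \<noteq> 0"
  then obtain q where q: "linear q" "\<And>x. \<bar>q x\<bar> \<le> norm x" "q z \<noteq> 0"
    using separating_functional by metis
  have "bounded_linear q"
    using q(1,2) by (intro bounded_linear_intro[of _ 1]) (auto simp: linear_add linear_scale)
  then show "\<exists>f\<in>topological_dual (*\<^sub>R) euclidean. f z \<noteq> 0"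
    using q by (intro bexI[of _ q])
      (auto simp: topological_dual_def linear_add linear_scale linear_continuous_on)
qed auto

text \<open>A real functional \<open>q\<close> is the real part of the complex functional \<open>x \<mapsto> q x - \<i> q (\<i> x)\<close>.\<close>

lemma normed_space_separating_dual_complex:
  fixes smul :: "complex \<Rightarrow> 'a::banach \<Rightarrow> 'a"
  assumes "complex_banach smul"
  shows "normed_space_separating_dual smul"
proof -
  interpret complex_banach smul by fact
  have "\<exists>f\<in>topological_dual smul euclidean. f z \<noteq> 0" if z: "z \<noteq> 0" for z
  proof -
    obtain q where q: "linear q" "\<And>x. \<bar>q x\<bar> \<le> norm x" "q z \<noteq> 0"
      using separating_functional[OF z] by metis
    have bl: "bounded_linear q"
      using q(1,2) by (intro bounded_linear_intro[of _ 1]) (auto simp: linear_add linear_scale)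
    have blI: "bounded_linear (smul \<i>)"
    proof (rule bounded_linear_intro[of _ 1])
      show "smul \<i> (r *\<^sub>R x) = r *\<^sub>R smul \<i> x" for r x
        by (simp add: smul_of_real[symmetric] mult.commute)
    qed (auto simp: scale_right_distrib norm_smul)
    define f where "f x = Complex (q x) (- q (smul \<i> x))" for x
    have "f (smul c x) = c * f x" for c x
    proof -
      have 1: "smul c x = Re c *\<^sub>R x + Im c *\<^sub>R smul \<i> x"
        by (simp add: smul_of_real[symmetric] scale_left_distrib[symmetric])
          (metis complex_eq mult.commute)
      have 2: "smul \<i> (smul c x) = Re c *\<^sub>R smul \<i> x - Im c *\<^sub>R x"
        by (simp add: smul_of_real[symmetric] scale_left_diff_distrib[symmetric])
          (simp add: complex_eq_iff)
      show ?thesis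
        unfolding f_def 2 unfolding 1 using q(1)
        by (simp add: complex_eq_iff linear_add linear_diff linear_scale)
    qed
    moreover have "f (x + y) = f x + f y" for x y
      using q(1) by (simp add: f_def complex_eq_iff linear_add scale_right_distrib)
    moreover have "continuous_on UNIV f"
      unfolding f_def Complex_eq
      by (intro continuous_intros linear_continuous_on bl bounded_linear_compose[OF bl blI])
    moreover have "f z \<noteq> 0" using q(3) by (simp add: f_def complex_eq_iff)
    ultimately show ?thesis by (intro bexI[of _ f]) (auto simp: topological_dual_def)
  qed
  then show ?thesis
    by unfold_locales (auto simp: smul_of_real norm_smul)
qed

theorem corollary2p9:
  shows "(infinite_dimensional ((*\<^sub>R) :: real \<Rightarrow> 'r \<Rightarrow> 'r) \<longrightarrow>
            \<not> strong_gelfand_phillips fun_scale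
                (weak_star_dual (*\<^sub>R) (euclidean :: ('r::banach) topology))) \<and>
         (\<forall>smul :: complex \<Rightarrow> 'c \<Rightarrow> 'c.
            complex_banach smul \<and> infinite_dimensional smul \<longrightarrow>
            \<not> strong_gelfand_phillips fun_scale
                (weak_star_dual smul (euclidean :: ('c::banach) topology)))"
  by (intro conjI allI impI normed_space_separating_dual.not_strong_gelfand_phillips
      normed_space_separating_dual_real normed_space_separating_dual_complex) simp_all

end
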